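(* Let $q=2^k$ for some positive integer $k$ and let $f:\mathbb{F}_q\to\mathbb{F}_q$ be a function. Then: (1) (The $2\times 2$ case) The following are equivalent: (a) $f$ preserves positivity on $M_2(\mathbb{F}_q)$. (b) $f$ is a bijective monomial on $\mathbb{F}_q$, that is, there exist $c\in\mathbb{F}_q^*$ and an integer $1\le n\le q-1$ with $\gcd(n,q-1)=1$ such that $f(x)=cx^n$ for all $x\in\mathbb{F}_q$. (2) (The $n\ge 3$ case) The following are equivalent: (a) $f$ preserves positivity on $M_n(\mathbb{F}_q)$ for some $n\ge 3$. (b) $f$ preserves positivity on $M_n(\mathbb{F}_q)$ for all $n\ge 2$. (c) $f$ is a non-zero multiple of a field automorphism of $\mathbb{F}_q$, i.e., there exist $c\in\mathbb{F}_q^*$ and $0\le \ell\le k-1$ such that $f(x)=cx^{2^\ell}$ for all $x\in\mathbb{F}_q$.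
   Context: $\mathbb{F}_q$ is the finite field with $q$ elements, $\mathbb{F}_q^*=\mathbb{F}_q\setminus\{0\}$, and $M_n(\mathbb{F}_q)$ is the set of $n\times n$ matrices over $\mathbb{F}_q$. A matrix $A\in M_n(\mathbb{F}_q)$ is called positive definite if $A$ is symmetric and all its leading principal minors are non-zero squares in $\mathbb{F}_q$. For $A=(a_{ij})$ and $f:\mathbb{F}_q\to\mathbb{F}_q$, write $f[A]:=(f(a_{ij}))$ (entrywise application). The function $f$ preserves positivity on $M_n(\mathbb{F}_q)$ if $f[A]$ is positive definite for every positive definite $A\in M_n(\mathbb{F}_q)$. *)

theory Defs
  imports
    "HOL-Library.Cardinality"
    "HOL-Computational_Algebra.Nth_Powers"
    "Jordan_Normal_Form.Determinant"
    "Jordan_Normal_Form.DL_Submatrix"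
begin

definition leading_principal_minor :: "'a::comm_ring_1 mat \<Rightarrow> nat \<Rightarrow> 'a" where
  "leading_principal_minor A m = det (submatrix A {..<m} {..<m})"

definition positive_definite :: "nat \<Rightarrow> 'a::field mat \<Rightarrow> bool" where
  "positive_definite n A \<longleftrightarrow>
     A \<in> carrier_mat n n \<and> transpose_mat A = A \<and>
     (\<forall>m\<in>{1..n}. leading_principal_minor A m \<noteq> 0 \<and> is_square (leading_principal_minor A m))"

definition preserves_positivity :: "nat \<Rightarrow> ('a::field \<Rightarrow> 'a) \<Rightarrow> bool" where
  "preserves_positivity n f \<longleftrightarrow>
     (\<forall>A. positive_definite n A \<longrightarrow> positive_definite n (map_mat f A))"

definition bijective_monomial :: "('a::field \<Rightarrow> 'a) \<Rightarrow> bool" where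
  "bijective_monomial f \<longleftrightarrow> bij f \<and> (\<exists>c n. c \<noteq> 0 \<and> (\<forall>x. f x = c * x ^ n))"

definition nonzero_multiple_of_automorphism :: "('a::field \<Rightarrow> 'a) \<Rightarrow> bool" where
  "nonzero_multiple_of_automorphism f \<longleftrightarrow>
     (\<exists>c \<sigma>. c \<noteq> 0 \<and> field_isom (\<sigma> :: 'a \<Rightarrow> 'a) \<and> (\<forall>x. f x = c * \<sigma> x))"

end

theory Submission
  imports Defs
begin

text \<open>
  In a field with \<open>q = 2 ^ k\<close> elements squaring is an injective map, hence a bijection, so
  every element is a square with a unique square root. Positive definiteness therefore only
  asks for symmetry and nonvanishing leading principal minors, and each single requirement
  on \<open>f\<close> has the form ``an equation fails for the entries, so it fails for their images''.
  The recurring step is to turn this around: all but one value of a free entry avoid the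
  equation, \<open>f\<close> is a bijection, so the one remaining value must be mapped to the
  remaining solution, and \<open>f\<close> preserves the equation itself.

  For \<open>2 \<times> 2\<close> matrices with rows \<open>(a, b)\<close> and \<open>(b, c)\<close> the equation is
  \<open>b\<^sup>2 = a * c\<close>. Taking \<open>c = a\<close> shows that \<open>f\<close> is injective, and turning the condition around
  shows that \<open>f\<close> commutes with geometric means
  (\<open>preserves_positivity_2_geometric_mean\<close>). Hence \<open>f\<close> divided by \<open>f 1\<close> is
  multiplicative. Every function on a finite field is a polynomial of degree below \<open>q\<close>, and
  comparing coefficients in \<open>g (x * y) = g x * g y\<close> shows that a multiplicative function is a
  power (\<open>multiplicative_function_is_power\<close>); the power map with exponent \<open>n\<close> is injective
  exactly if \<open>n\<close> is coprime to \<open>q - 1\<close>. Conversely an injective power map respects both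
  \<open>b\<^sup>2 = a * c\<close> and its failure.

  Preservation in some size \<open>n\<close> implies preservation in all smaller sizes, by padding with an
  identity block. So \<open>n \<ge> 3\<close> can be replaced by \<open>3\<close>, and \<open>f\<close> is a multiple of a power by
  the first part. The symmetric matrix with rows \<open>(1, 0, d)\<close>, \<open>(0, 1, e)\<close>,
  \<open>(d, e, g)\<close> has determinant \<open>g - d\<^sup>2 - e\<^sup>2\<close>, and the same reversal shows that \<open>f\<close> is
  additive (\<open>preserves_positivity_3_additive\<close>). A power map with exponent below \<open>q\<close>
  that satisfies \<open>(x + 1) ^ n = x ^ n + 1\<close> has a power of the characteristic as exponent
  (\<open>additive_power_exponent\<close>), since a polynomial identity of degree below \<open>q\<close> that holds
  pointwise holds formally. Conversely, a field automorphism maps each minor to its image and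
  a scalar factor \<open>c\<close> multiplies the minor of size \<open>m\<close> by \<open>c ^ m\<close>.
\<close>

section \<open>Functions on finite fields\<close>

text \<open>Multiplication by \<open>x\<close> permutes the nonzero elements, so it leaves their product unchanged.\<close>

lemma nonzero_power_card_minus_one:
  fixes x :: "'a::{field,finite}"
  assumes "x \<noteq> 0"
  shows "x ^ (CARD('a) - 1) = 1"
proof -
  let ?U = "UNIV - {0 :: 'a}"
  have "(\<lambda>y. x * y) ` ?U = ?U"
    using assms by (intro card_subset_eq card_image injI inj_onI) (auto simp: card_image inj_on_def)
  moreover have "inj_on (\<lambda>y. x * y) ?U"
    using assms by (auto simp: inj_on_def)
  ultimately have "prod (\<lambda>y. y) ?U = (\<Prod>y\<in>?U. x * y)"
    by (metis (no_types, lifting) prod.reindex_cong)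
  also have "\<dots> = x ^ (CARD('a) - 1) * prod (\<lambda>y. y) ?U"
    by (simp add: prod.distrib card_Diff_singleton)
  finally show ?thesis
    by simp
qed

lemma finite_field_power_card:
  fixes x :: "'a::{field,finite}"
  shows "x ^ CARD('a) = x"
proof (cases "x = 0")
  case False
  have "x ^ CARD('a) = x * x ^ (CARD('a) - 1)"
    by (metis power_eq_if zero_less_card_finite less_irrefl)
  with nonzero_power_card_minus_one[OF False] show ?thesis
    by simp
qed (simp add: power_0_left)

lemma CARD_field_gt_1: "CARD('a::{field,finite}) > 1"
proof -
  have "card {0, 1 :: 'a} \<le> CARD('a)"
    by (intro card_mono) auto
  then show ?thesis by simp
qed

text \<open>
  The polynomial \<open>1 - (X - a) ^ (q - 1)\<close> is the indicator function of \<open>a\<close>; Lagrange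
  interpolation thus needs no quotients.
\<close>

lemma finite_field_function_is_polynomial:
  fixes g :: "'a::{field,finite} \<Rightarrow> 'a"
  shows "\<exists>p. degree p < CARD('a) \<and> (\<forall>x. poly p x = g x)"
proof (intro exI conjI allI)
  let ?p = "\<Sum>a\<in>UNIV. smult (g a) (1 - [:- a, 1:] ^ (CARD('a) - 1))"
  have "degree ?p \<le> CARD('a) - 1"
    by (intro degree_sum_le degree_smult_le[THEN order_trans] degree_diff_le)
       (auto simp: degree_linear_power)
  then show "degree ?p < CARD('a)"
    using CARD_field_gt_1[where 'a = 'a] by linarith
  fix x
  have "poly ?p x = (\<Sum>a\<in>UNIV. if a = x then g a else 0)"
    unfolding poly_sum
  proof (rule sum.cong[OF refl])
    fix a
    show "poly (smult (g a) (1 - [:- a, 1:] ^ (CARD('a) - 1))) x = (if a = x then g a else 0)"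
      using nonzero_power_card_minus_one[of "x - a"] CARD_field_gt_1[where 'a = 'a]
      by (auto simp: power_0_left)
  qed
  then show "poly ?p x = g x"
    by simp
qed

text \<open>
  Represent \<open>g\<close> by a polynomial \<open>p\<close> of degree below \<open>q\<close>. For fixed \<open>y\<close> the polynomials
  \<open>p (y * X)\<close> and \<open>g y * p\<close> agree at all \<open>q\<close> points, hence formally; their leading
  coefficients give \<open>g y = y ^ degree p\<close>. This avoids a generator of the multiplicative
  group.
\<close>

lemma multiplicative_function_is_power:
  fixes g :: "'a::{field,finite} \<Rightarrow> 'a"
  assumes mult: "\<And>x y. g (x * y) = g x * g y" and "g 1 \<noteq> 0"
  shows "\<exists>n < CARD('a). \<forall>x. g x = x ^ n"
proof -
  obtain p where deg: "degree p < CARD('a)" and p: "\<And>x. poly p x = g x"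
    using finite_field_function_is_polynomial[of g] by blast
  have "p \<noteq> 0"
    using p[of 1] \<open>g 1 \<noteq> 0\<close> by auto
  have "g y = y ^ degree p" for y
  proof -
    have "p \<circ>\<^sub>p [:0, y:] = smult (g y) p"
    proof (rule poly_eqI_degree[where A = UNIV])
      show "poly (p \<circ>\<^sub>p [:0, y:]) x = poly (smult (g y) p) x" for x
        by (simp add: poly_pcompose p mult[symmetric] mult.commute)
      have "degree (p \<circ>\<^sub>p [:0, y:]) \<le> degree p * 1"
        by (intro degree_pcompose_le[THEN order_trans] mult_le_mono) auto
      then show "degree (p \<circ>\<^sub>p [:0, y:]) < CARD('a)"
        using deg by simp
      show "degree (smult (g y) p) < CARD('a)"
        using deg by (meson degree_smult_le order_le_less_trans)
    qed
    then have "coeff (p \<circ>\<^sub>p [:0, y:]) (degree p) = g y * lead_coeff p"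
      by simp
    then show ?thesis
      using \<open>p \<noteq> 0\<close> by (simp add: coeff_pcompose_linear)
  qed
  with deg show ?thesis by blast
qed

text \<open>
  With \<open>d = gcd n (q - 1)\<close> and \<open>m = (q - 1) / d\<close>, the power map sends each \<open>x ^ m\<close> to
  \<open>1\<close> for nonzero \<open>x\<close>; if it is injective, then \<open>X ^ m - 1\<close> has \<open>q - 1\<close> roots, which forces
  \<open>m = q - 1\<close>. If \<open>d = 1\<close>, a Bezout inverse of \<open>n\<close> modulo \<open>q - 1\<close> gives an inverse map.
\<close>

lemma inj_power_iff_coprime:
  assumes "n > 0"
  shows "inj (\<lambda>x::'a::{field,finite}. x ^ n) \<longleftrightarrow> coprime n (CARD('a) - 1)"
proof
  let ?N = "CARD('a) - 1"
  have "?N > 0" using CARD_field_gt_1[where 'a = 'a] by simp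
  assume inj: "inj (\<lambda>x::'a. x ^ n)"
  define d where "d = gcd n ?N"
  obtain m where m: "?N = d * m" unfolding d_def by (metis dvdE gcd_dvd2)
  obtain r where r: "n = d * r" unfolding d_def by (metis dvdE gcd_dvd1)
  have "m > 0" using m \<open>?N > 0\<close> by (cases m) auto
  have "x ^ m = 1" if "x \<noteq> 0" for x :: 'a
  proof -
    have "(x ^ m) ^ n = (x ^ ?N) ^ r"
      unfolding m by (subst r) (simp add: power_mult[symmetric] ac_simps)
    also have "\<dots> = 1 ^ n"
      using nonzero_power_card_minus_one[OF that] by simp
    finally show ?thesis
      using injD[OF inj, of "x ^ m" 1] by simp
  qed
  then have "card (UNIV - {0 :: 'a}) \<le> card {x. poly (monom 1 m - 1) x = (0 :: 'a)}"
    using \<open>m > 0\<close> by (intro card_mono) (auto simp: poly_monom)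
  also have "monom 1 m - 1 \<noteq> (0 :: 'a poly)"
    using \<open>m > 0\<close> by (metis degree_1 degree_monom_eq eq_iff_diff_eq_0 less_irrefl one_neq_zero)
  then have "card {x. poly (monom 1 m - 1) x = (0 :: 'a)} \<le> degree (monom 1 m - 1 :: 'a poly)"
    by (rule card_poly_roots_bound)
  also have "\<dots> \<le> m"
    by (intro degree_diff_le) (auto simp: degree_monom_le)
  finally have "?N \<le> m" by (simp add: card_Diff_singleton)
  then have "d = 1"
    using m \<open>?N > 0\<close> by (cases d) auto
  then show "coprime n ?N" by (simp add: d_def coprime_iff_gcd_eq_1)
next
  let ?N = "CARD('a) - 1"
  assume cop: "coprime n ?N"
  obtain u v where uv: "n * u = ?N * v + 1"
    using bezout_nat[of n ?N] cop assms by (metis coprime_iff_gcd_eq_1 less_irrefl)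
  have "(x ^ n) ^ u = x" for x :: 'a
  proof (cases "x = 0")
    case True
    then show ?thesis using uv assms by (cases u) (auto simp: power_0_left)
  next
    case False
    have "(x ^ n) ^ u = (x ^ ?N) ^ v * x"
      unfolding power_mult[symmetric] uv by simp
    with nonzero_power_card_minus_one[OF False] show ?thesis by simp
  qed
  then show "inj (\<lambda>x::'a. x ^ n)" by (metis injI)
qed

lemma prime_CHAR_finite_field: "prime CHAR('a::{field,finite})"
  using finite_imp_CHAR_pos[where 'a = 'a] prime_CHAR_semidom[where 'a = 'a] by simp

lemma frobenius_power_inj: "inj (\<lambda>x::'a::{field,finite}. x ^ (CHAR('a) ^ l))"
proof (rule injI)
  fix x y :: 'a
  assume *: "x ^ (CHAR('a) ^ l) = y ^ (CHAR('a) ^ l)"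
  have "x ^ (CHAR('a) ^ l) = (x - y) ^ (CHAR('a) ^ l) + y ^ (CHAR('a) ^ l)"
    using freshmans_dream'[OF prime_CHAR_finite_field refl, of "x - y" y l] by simp
  with * show "x = y" by simp
qed

text \<open>
  Split \<open>n = p ^ l * m\<close> with \<open>m\<close> prime to the characteristic \<open>p\<close>. Injectivity of the
  Frobenius power transfers the hypothesis from \<open>n\<close> to \<open>m\<close>, and since \<open>m\<close> is smaller than
  the number of elements, \<open>(X + 1) ^ m = X ^ m + 1\<close> holds formally. The coefficient of \<open>X\<close> on
  the left is \<open>m\<close>, which is not zero in the field; on the right it is zero unless \<open>m = 1\<close>.
\<close>

lemma additive_power_exponent:
  assumes "0 < n" and "n < CARD('a)"
    and add: "\<And>x::'a::{field,finite}. (x + 1) ^ n = x ^ n + 1"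
  shows "\<exists>l. n = CHAR('a) ^ l"
proof -
  let ?p = "CHAR('a)"
  have "\<not> is_unit ?p"
    using prime_CHAR_finite_field[where 'a = 'a] not_prime_unit by blast
  then obtain m where n: "n = ?p ^ multiplicity ?p n * m" and m: "\<not> ?p dvd m"
    using multiplicity_decompose'[of n ?p] \<open>0 < n\<close> by auto
  define P where "P = ?p ^ multiplicity ?p n"
  have add_m: "(x + 1) ^ m = x ^ m + 1" for x :: 'a
  proof -
    have "((x + 1) ^ m) ^ P = (x ^ m) ^ P + 1 ^ P"
      using add[of x] n by (simp add: P_def mult.commute flip: power_mult)
    also have "\<dots> = (x ^ m + 1) ^ P"
      unfolding P_def by (rule freshmans_dream'[OF prime_CHAR_finite_field refl, symmetric])
    finally show ?thesis
      using frobenius_power_inj[where 'a = 'a] unfolding P_def by (auto dest: injD)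
  qed
  have "m > 0" using m by (cases m) auto
  have "m \<le> n" using n \<open>0 < n\<close> P_def by (metis dvd_imp_le dvd_triv_right)
  have "[:1, 1:] ^ m = monom 1 m + (1 :: 'a poly)"
  proof (rule poly_eqI_degree[where A = UNIV])
    show "poly ([:1, 1:] ^ m) x = poly (monom 1 m + 1) x" for x :: 'a
      using add_m[of x] by (simp add: poly_monom add.commute)
    show "degree ([:1, 1:] ^ m :: 'a poly) < CARD('a)"
      using \<open>m \<le> n\<close> \<open>n < CARD('a)\<close> by (simp add: degree_linear_power)
    have "degree (monom 1 m + 1 :: 'a poly) \<le> m"
      by (intro degree_add_le) (auto simp: degree_monom_le)
    then show "degree (monom 1 m + 1 :: 'a poly) < CARD('a)"
      using \<open>m \<le> n\<close> \<open>n < CARD('a)\<close> by simp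
  qed
  \<comment> \<open>The value of the derivative at \<open>0\<close> is the coefficient of \<open>X\<close>.\<close>
  then have "poly (pderiv ([:1, 1:] ^ m)) 0 = poly (pderiv (monom 1 m + (1 :: 'a poly))) 0"
    by simp
  then have "(of_nat m :: 'a) = of_nat m * 0 ^ (m - 1)"
    by (simp add: pderiv_power pderiv_add pderiv_monom poly_monom pderiv_pCons)
  moreover have "(of_nat m :: 'a) \<noteq> 0"
    using m by (simp add: of_nat_eq_0_iff_char_dvd)
  ultimately have "m = 1"
    using \<open>m > 0\<close> by (cases "m = 1") (auto simp: power_0_left)
  with n show ?thesis by auto
qed

section \<open>Characteristic two\<close>

text \<open>Since \<open>x ^ q = x\<close> and \<open>q\<close> is even, \<open>- 1 = (- 1) ^ q = 1\<close>.\<close>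

lemma CHAR_eq_2:
  assumes "CARD('a::{field,finite}) = 2 ^ k" and "k > 0"
  shows "CHAR('a) = 2"
proof -
  have "(- 1 :: 'a) = (- 1) ^ CARD('a)"
    by (rule finite_field_power_card[symmetric])
  also have "\<dots> = 1"
    using assms by (simp add: power_minus_even)
  finally have "of_nat 2 = (0 :: 'a)"
    by (metis add.right_inverse of_nat_numeral one_add_one)
  then have "CHAR('a) dvd 2"
    using of_nat_eq_0_iff_char_dvd by blast
  then show ?thesis
    using prime_CHAR_finite_field[where 'a = 'a] primes_dvd_imp_eq two_is_prime_nat by blast
qed

lemma CHAR_2_uminus:
  assumes "CHAR('a::{field,finite}) = 2"
  shows "- x = (x :: 'a)"
proof -
  have "(2 :: 'a) = 0" using assms of_nat_CHAR[where 'a = 'a] by simp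
  then have "x + x = 0" by (simp flip: mult_2)
  then show ?thesis by (rule minus_unique)
qed

lemma CHAR_2_square_inj:
  assumes "CHAR('a::{field,finite}) = 2" and "x\<^sup>2 = (y :: 'a)\<^sup>2"
  shows "x = y"
  using assms CHAR_2_uminus[of y] by (auto simp: power2_eq_iff)

lemma CHAR_2_square_surj:
  fixes x :: "'a::{field,finite}"
  assumes "CHAR('a) = 2"
  obtains y where "x = y\<^sup>2"
proof -
  have "inj (\<lambda>y::'a. y\<^sup>2)"
    using CHAR_2_square_inj[OF assms] by (blast intro: injI)
  then have "surj (\<lambda>y::'a. y\<^sup>2)"
    by (simp add: finite_UNIV_inj_surj)
  with that show ?thesis by (metis surjD)
qed

section \<open>Leading principal minors\<close>

text \<open>
  Taking the submatrix with index set \<open>{..<m}\<close> enumerates that set in increasing order, so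
  it does not renumber rows or columns.
\<close>

lemma leading_principal_minor_eq_det:
  assumes "A \<in> carrier_mat n n" and "m \<le> n"
  shows "leading_principal_minor A m = det (mat m m (\<lambda>ij. A $$ ij))"
proof -
  have card: "card {i. i < n \<and> i \<in> {..<m}} = m"
  proof -
    have "{i. i < n \<and> i \<in> {..<m}} = {..<m}" using \<open>m \<le> n\<close> by auto
    then show ?thesis by simp
  qed
  \<comment> \<open>In a submatrix the new number of a row \<open>i\<close> is the number of selected rows before \<open>i\<close>.\<close>
  have init: "card {a \<in> {..<m}. a < i} = i" if "i < m" for i
  proof -
    have "{a \<in> {..<m}. a < i} = {..<i}" using that by auto
    then show ?thesis by simp
  qed
  have "submatrix A {..<m} {..<m} = mat m m (\<lambda>ij. A $$ ij)"
  proof (rule eq_matI)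
    fix i j assume "i < dim_row (mat m m (\<lambda>ij. A $$ ij))" "j < dim_col (mat m m (\<lambda>ij. A $$ ij))"
    then have "i < m" "j < m" by auto
    then show "submatrix A {..<m} {..<m} $$ (i, j) = mat m m (\<lambda>ij. A $$ ij) $$ (i, j)"
      using submatrix_index_card[of i A j "{..<m}" "{..<m}"] assms init by auto
  qed (use assms card in \<open>simp_all add: dim_submatrix\<close>)
  then show ?thesis by (simp add: leading_principal_minor_def)
qed

lemma positive_definite_iff_nonzero_minors:
  fixes A :: "'a::{field,finite} mat"
  assumes "CHAR('a) = 2"
  shows "positive_definite n A \<longleftrightarrow>
    A \<in> carrier_mat n n \<and> transpose_mat A = A \<and>
    (\<forall>m\<in>{1..n}. det (mat m m (\<lambda>ij. A $$ ij)) \<noteq> 0)"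
proof -
  have "is_square x" for x :: 'a
    using CHAR_2_square_surj[OF assms, of x] by (metis is_nth_power_nth_power)
  then show ?thesis
    unfolding positive_definite_def by (auto simp: leading_principal_minor_eq_det)
qed

lemma positive_definite_identity_pad:
  fixes A :: "'a::{field,finite} mat"
  assumes "CHAR('a) = 2" and A: "positive_definite m A"
  shows "positive_definite (m + d) (four_block_mat A (0\<^sub>m m d) (0\<^sub>m d m) (1\<^sub>m d))"
    (is "positive_definite _ ?B")
proof -
  have cA: "A \<in> carrier_mat m m" and tA: "transpose_mat A = A"
    and dA: "\<And>r. r \<in> {1..m} \<Longrightarrow> det (mat r r (\<lambda>ij. A $$ ij)) \<noteq> 0"
    using A by (auto simp: positive_definite_iff_nonzero_minors[OF assms(1)])
  have det_A: "det A \<noteq> 0"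
  proof (cases "m = 0")
    case True
    then show ?thesis using cA by simp
  next
    case False
    have "mat m m (\<lambda>ij. A $$ ij) = A" using cA by auto
    then show ?thesis using dA[of m] False by simp
  qed
  have symA: "A $$ (i, j) = A $$ (j, i)" if "i < m" "j < m" for i j
    using that cA tA by (metis carrier_matD index_transpose_mat(1))
  have "transpose_mat ?B = ?B"
    by (rule eq_matI) (use cA in \<open>auto simp: symA\<close>)
  moreover have "det (mat r r (\<lambda>ij. ?B $$ ij)) \<noteq> 0" if r: "r \<in> {1..m + d}" for r
  proof (cases "r \<le> m")
    case True
    then have "mat r r (\<lambda>ij. ?B $$ ij) = mat r r (\<lambda>ij. A $$ ij)"
      by (intro eq_matI) (use cA in auto)
    then show ?thesis using dA[of r] r True by simp
  next
    case False
    let ?C = "four_block_mat A (0\<^sub>m m (r - m)) (0\<^sub>m (r - m) m) (1\<^sub>m (r - m))"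
    have "mat r r (\<lambda>ij. ?B $$ ij) = ?C"
      by (rule eq_matI) (use cA r False in auto)
    moreover have "det ?C = det A * det (1\<^sub>m (r - m) :: 'a mat)"
      by (rule det_four_block_mat_upper_right_zero[OF cA refl]) auto
    ultimately show ?thesis using det_A by simp
  qed
  ultimately show ?thesis
    using cA by (simp add: positive_definite_iff_nonzero_minors[OF assms(1)])
qed

text \<open>
  The leading minors of size at most \<open>m\<close> do not see the padding. Those of the image of the
  padded matrix are therefore the minors of the image of the original matrix, whatever
  \<open>f\<close> does to the zeros and ones outside the upper left block.
\<close>

lemma preserves_positivity_mono:
  fixes f :: "'a::{field,finite} \<Rightarrow> 'a"
  assumes "CHAR('a) = 2" and "m \<le> n" and f: "preserves_positivity n f"
  shows "preserves_positivity m f"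
  unfolding preserves_positivity_def
proof (intro allI impI)
  fix A :: "'a mat"
  assume A: "positive_definite m A"
  then have cA: "A \<in> carrier_mat m m" and tA: "transpose_mat A = A"
    by (auto simp: positive_definite_def)
  let ?B = "four_block_mat A (0\<^sub>m m (n - m)) (0\<^sub>m (n - m) m) (1\<^sub>m (n - m))"
  have "positive_definite n ?B"
    using positive_definite_identity_pad[OF assms(1) A, of "n - m"] \<open>m \<le> n\<close> by simp
  then have B: "positive_definite n (map_mat f ?B)"
    using f by (simp add: preserves_positivity_def)
  have "det (mat r r (\<lambda>ij. map_mat f A $$ ij)) \<noteq> 0" if r: "r \<in> {1..m}" for r
  proof -
    have "mat r r (\<lambda>ij. map_mat f A $$ ij) = mat r r (\<lambda>ij. map_mat f ?B $$ ij)"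
      by (intro eq_matI) (use cA r in auto)
    then show ?thesis
      using B r \<open>m \<le> n\<close> by (simp add: positive_definite_iff_nonzero_minors[OF assms(1)])
  qed
  moreover have "transpose_mat (map_mat f A) = map_mat f (transpose_mat A)"
    by auto
  ultimately show "positive_definite m (map_mat f A)"
    using cA tA by (simp add: positive_definite_iff_nonzero_minors[OF assms(1)])
qed

section \<open>Symmetric matrices of size two and three\<close>

definition sym2 :: "'a \<Rightarrow> 'a \<Rightarrow> 'a \<Rightarrow> 'a mat" where
  "sym2 a b c = mat 2 2 (\<lambda>(i, j). if i \<noteq> j then b else if i = 0 then a else c)"

text \<open>
  The symmetric matrix with rows \<open>(s, 0, d)\<close>, \<open>(0, s, e)\<close>, \<open>(d, e, g)\<close>. The parameter
  \<open>s\<close> keeps the family closed under entrywise maps that fix \<open>0\<close> and may move \<open>1\<close>.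
\<close>

definition bordered_scalar :: "'a::zero \<Rightarrow> 'a \<Rightarrow> 'a \<Rightarrow> 'a \<Rightarrow> 'a mat" where
  "bordered_scalar s d e g = mat 3 3 (\<lambda>(i, j).
     if i = 2 \<and> j = 2 then g else if i = j then s
     else if i + j = 2 then d else if i + j = 3 then e else 0)"

lemma det_2x2:
  assumes "A \<in> carrier_mat 2 2"
  shows "det (A :: 'a::comm_ring_1 mat) = A $$ (0, 0) * A $$ (1, 1) - A $$ (0, 1) * A $$ (1, 0)"
proof -
  have "det A = (\<Sum>i<2. A $$ (i, 0) * cofactor A i 0)"
    by (rule laplace_expansion_column[OF assms]) simp
  moreover have "det (mat_delete A i 0) = mat_delete A i 0 $$ (0, 0)" for i
    using mat_delete_carrier[OF assms, of i 0] by (intro det_single) simp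
  ultimately show ?thesis
    using assms
    by (simp add: cofactor_def numeral_2_eq_2) (simp add: mat_delete_def algebra_simps)
qed

lemma mat_nth_carrier [simp]: "A \<in> carrier_mat n n \<Longrightarrow> mat n n (\<lambda>ij. A $$ ij) = A"
  by auto

lemma det_sym2: "det (sym2 a b c) = a * c - b\<^sup>2" for a :: "'a::comm_ring_1"
  by (subst det_2x2) (auto simp: sym2_def power2_eq_square)

lemma det_bordered_scalar:
  "det (bordered_scalar s d e g) = s * (s * g - d\<^sup>2 - e\<^sup>2)" for s :: "'a::comm_ring_1"
proof -
  let ?A = "bordered_scalar s d e g"
  have c: "?A \<in> carrier_mat 3 3" by (simp add: bordered_scalar_def)
  have "det ?A = (\<Sum>i<3. ?A $$ (i, 0) * cofactor ?A i 0)"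
    by (rule laplace_expansion_column[OF c]) simp
  moreover have "mat_delete ?A i 0 \<in> carrier_mat 2 2" for i
    using mat_delete_carrier[OF c, of i 0] by simp
  ultimately show ?thesis
    by (simp add: cofactor_def det_2x2 numeral_3_eq_3)
       (simp add: mat_delete_def bordered_scalar_def power2_eq_square algebra_simps)
qed

lemma minor_1: "det (mat (Suc 0) (Suc 0) (\<lambda>ij. A $$ ij)) = A $$ (0, 0)"
  by (subst det_single) auto

lemma positive_definite_2_iff:
  fixes A :: "'a::{field,finite} mat"
  assumes "CHAR('a) = 2"
  shows "positive_definite 2 A \<longleftrightarrow> (\<exists>a b c. A = sym2 a b c \<and> a \<noteq> 0 \<and> b\<^sup>2 \<noteq> a * c)"
proof -
  have I: "{1..2} = {1, 2::nat}" by auto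
  have sym: "positive_definite 2 (sym2 a b c) \<longleftrightarrow> a \<noteq> 0 \<and> b\<^sup>2 \<noteq> a * c" for a b c :: 'a
  proof -
    have "sym2 a b c \<in> carrier_mat 2 2" "transpose_mat (sym2 a b c) = sym2 a b c"
      by (auto simp: sym2_def intro!: eq_matI)
    then show ?thesis
      unfolding positive_definite_iff_nonzero_minors[OF assms] I
      by (simp add: minor_1 det_sym2) (auto simp: sym2_def)
  qed
  have "A = sym2 (A $$ (0, 0)) (A $$ (0, 1)) (A $$ (1, 1))" if "positive_definite 2 A"
  proof -
    have c: "A \<in> carrier_mat 2 2" and t: "transpose_mat A = A"
      using that by (auto simp: positive_definite_def)
    then have "A $$ (1, 0) = A $$ (0, 1)"
      by (metis carrier_matD index_transpose_mat(1) one_less_numeral_iff semiring_norm(76) zero_less_numeral)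
    then show ?thesis
      using c by (intro eq_matI) (auto simp: sym2_def less_2_cases_iff)
  qed
  then show ?thesis using sym by metis
qed

lemma map_mat_sym2: "map_mat f (sym2 a b c) = sym2 (f a) (f b) (f c)"
  by (auto simp: sym2_def)

lemma sym2_inject: "sym2 a b c = sym2 a' b' c' \<longleftrightarrow> a = a' \<and> b = b' \<and> c = c'"
proof
  assume *: "sym2 a b c = sym2 a' b' c'"
  show "a = a' \<and> b = b' \<and> c = c'"
    using arg_cong[OF *, of "\<lambda>A. A $$ (0, 0)"] arg_cong[OF *, of "\<lambda>A. A $$ (0, 1)"]
      arg_cong[OF *, of "\<lambda>A. A $$ (1, 1)"]
    by (simp add: sym2_def)
qed simp

lemma preserves_positivity_2_iff:
  fixes f :: "'a::{field,finite} \<Rightarrow> 'a"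
  assumes "CHAR('a) = 2"
  shows "preserves_positivity 2 f \<longleftrightarrow>
    (\<forall>a b c. a \<noteq> 0 \<and> b\<^sup>2 \<noteq> a * c \<longrightarrow> f a \<noteq> 0 \<and> (f b)\<^sup>2 \<noteq> f a * f c)"
  unfolding preserves_positivity_def positive_definite_2_iff[OF assms]
  by (fastforce simp: map_mat_sym2 sym2_inject)

lemma positive_definite_bordered_scalar_iff:
  fixes s d e g :: "'a::{field,finite}"
  assumes "CHAR('a) = 2"
  shows "positive_definite 3 (bordered_scalar s d e g) \<longleftrightarrow> s \<noteq> 0 \<and> s * g \<noteq> d\<^sup>2 + e\<^sup>2"
proof -
  let ?A = "bordered_scalar s d e g"
  have I: "{1..3} = {1, 2, 3::nat}" by auto
  have "?A \<in> carrier_mat 3 3" "transpose_mat ?A = ?A"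
    by (auto simp: bordered_scalar_def add.commute intro!: eq_matI)
  moreover have "mat 2 2 (\<lambda>ij. ?A $$ ij) = sym2 s 0 s"
    by (auto simp: bordered_scalar_def sym2_def less_2_cases_iff intro!: eq_matI)
  moreover have "?A $$ (0, 0) = s"
    by (simp add: bordered_scalar_def)
  moreover have "s * g - d\<^sup>2 - e\<^sup>2 = 0 \<longleftrightarrow> s * g = d\<^sup>2 + e\<^sup>2"
    by (simp add: algebra_simps)
  ultimately show ?thesis
    unfolding positive_definite_iff_nonzero_minors[OF assms] I
    by (auto simp: minor_1 det_sym2 det_bordered_scalar)
qed

section \<open>Functions that preserve positivity\<close>

text \<open>
  Equal diagonal entries \<open>a\<close> and off-diagonal entry \<open>b\<close> give the determinant
  \<open>a\<^sup>2 - b\<^sup>2 = (a - b)\<^sup>2\<close>, which vanishes only for \<open>a = b\<close>.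
\<close>

lemma preserves_positivity_2_bij:
  fixes f :: "'a::{field,finite} \<Rightarrow> 'a"
  assumes char: "CHAR('a) = 2" and f: "preserves_positivity 2 f"
  shows "bij f"
proof -
  have "f a \<noteq> f b" if "a \<noteq> b" "a \<noteq> 0" for a b
  proof -
    have "b\<^sup>2 \<noteq> a * a"
      using that CHAR_2_square_inj[OF char, of b a] by (auto simp: power2_eq_square)
    then have "(f b)\<^sup>2 \<noteq> f a * f a"
      using f that by (simp add: preserves_positivity_2_iff[OF char])
    then show ?thesis by (auto simp: power2_eq_square)
  qed
  then have "inj f" by (metis injI)
  then show ?thesis by (simp add: bij_def finite_UNIV_inj_surj)
qed

text \<open>
  Some \<open>b'\<close> is mapped to the square root of \<open>f a * f c\<close>, because \<open>f\<close> is surjective. If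
  \<open>b'\<close> were not the square root of \<open>a * c\<close>, the matrix with rows \<open>(a, b')\<close> and
  \<open>(b', c)\<close> would be positive definite with a singular image.
\<close>

lemma preserves_positivity_2_geometric_mean:
  fixes f :: "'a::{field,finite} \<Rightarrow> 'a"
  assumes char: "CHAR('a) = 2" and f: "preserves_positivity 2 f" and "a \<noteq> 0" and "b\<^sup>2 = a * c"
  shows "(f b)\<^sup>2 = f a * f c"
proof -
  obtain y where y: "f a * f c = y\<^sup>2" by (rule CHAR_2_square_surj[OF char])
  obtain b' where b': "y = f b'"
    using preserves_positivity_2_bij[OF char f] by (metis bij_pointE)
  have "b'\<^sup>2 = a * c"
    using f \<open>a \<noteq> 0\<close> y b' by (metis preserves_positivity_2_iff[OF char])
  then have "b' = b"
    using \<open>b\<^sup>2 = a * c\<close> by (metis CHAR_2_square_inj[OF char])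
  with y b' show ?thesis by simp
qed

lemma preserves_positivity_2_zero:
  fixes f :: "'a::{field,finite} \<Rightarrow> 'a"
  assumes char: "CHAR('a) = 2" and f: "preserves_positivity 2 f"
  shows "f x = 0 \<longleftrightarrow> x = 0"
proof -
  have inj: "inj f" using preserves_positivity_2_bij[OF assms] by (rule bij_is_inj)
  have "(f 0)\<^sup>2 = f 1 * f 0"
    by (rule preserves_positivity_2_geometric_mean[OF assms]) auto
  moreover have "f 0 \<noteq> f 1"
    using inj by (metis injD zero_neq_one)
  ultimately have "f 0 = 0" by (simp add: power2_eq_square)
  then show ?thesis using inj by (metis injD)
qed

text \<open>
  With \<open>b\<^sup>2 = x * y\<close>, the value \<open>(f b)\<^sup>2\<close> is both \<open>f x * f y\<close> and \<open>f 1 * f (x * y)\<close>.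
  Hence \<open>f / f 1\<close> is multiplicative.
\<close>

lemma preserves_positivity_2_imp_power:
  fixes f :: "'a::{field,finite} \<Rightarrow> 'a"
  assumes char: "CHAR('a) = 2" and f: "preserves_positivity 2 f"
  shows "\<exists>c n. c \<noteq> 0 \<and> 1 \<le> n \<and> n \<le> CARD('a) - 1 \<and> gcd n (CARD('a) - 1) = 1 \<and>
    (\<forall>x. f x = c * x ^ n)"
proof -
  define g where "g x = f x / f 1" for x
  have f1: "f 1 \<noteq> 0" by (simp add: preserves_positivity_2_zero[OF assms])
  have f0: "f 0 = 0" by (simp add: preserves_positivity_2_zero[OF assms])
  have "g (x * y) = g x * g y" for x y
  proof (cases "x = 0")
    case False
    obtain b where b: "x * y = b\<^sup>2" by (rule CHAR_2_square_surj[OF char])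
    have "(f b)\<^sup>2 = f 1 * f (x * y)"
      by (rule preserves_positivity_2_geometric_mean[OF assms]) (use b in auto)
    moreover have "(f b)\<^sup>2 = f x * f y"
      by (rule preserves_positivity_2_geometric_mean[OF assms]) (use b False in auto)
    ultimately show ?thesis using f1 by (simp add: g_def field_simps)
  qed (simp add: g_def f0)
  moreover have "g 1 \<noteq> 0" using f1 by (simp add: g_def)
  ultimately obtain n where n: "n < CARD('a)" and g: "\<And>x. g x = x ^ n"
    using multiplicative_function_is_power[of g] by blast
  have fn: "f x = f 1 * x ^ n" for x
    using g[of x] f1 by (simp add: g_def field_simps)
  have "n > 0"
    using fn[of 0] f0 f1 by (cases n) auto
  have "inj (\<lambda>x::'a. x ^ n)"
    using preserves_positivity_2_bij[OF assms] fn by (metis bij_is_inj injD injI)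
  then have "coprime n (CARD('a) - 1)"
    using \<open>n > 0\<close> by (simp add: inj_power_iff_coprime)
  moreover have "n \<le> CARD('a) - 1"
    using n by simp
  moreover have "1 \<le> n"
    using \<open>n > 0\<close> by simp
  ultimately show ?thesis
    using f1 fn coprime_imp_gcd_eq_1 by blast
qed

lemma coprime_power_imp_bijective_monomial:
  fixes f :: "'a::{field,finite} \<Rightarrow> 'a"
  assumes "c \<noteq> 0" and "1 \<le> n" and "coprime n (CARD('a) - 1)" and f: "\<And>x. f x = c * x ^ n"
  shows "bijective_monomial f"
proof -
  have "inj (\<lambda>x::'a. x ^ n)" using assms by (simp add: inj_power_iff_coprime)
  then have "inj f" using f \<open>c \<noteq> 0\<close> by (auto simp: inj_def)
  then have "bij f" by (metis bij_def finite_UNIV_inj_surj finite)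
  then show ?thesis
    using \<open>c \<noteq> 0\<close> f unfolding bijective_monomial_def by blast
qed

lemma bijective_monomial_preserves_positivity_2:
  fixes f :: "'a::{field,finite} \<Rightarrow> 'a"
  assumes char: "CHAR('a) = 2" and "bijective_monomial f"
  shows "preserves_positivity 2 f"
proof -
  obtain c n where "bij f" "c \<noteq> 0" and f: "\<And>x. f x = c * x ^ n"
    using assms(2) by (auto simp: bijective_monomial_def)
  have inj: "x = y" if "x ^ n = y ^ n" for x y :: 'a
    using \<open>bij f\<close> that f by (metis bij_is_inj injD)
  have "n \<noteq> 0" using inj[of 0 1] by (cases n) auto
  have "(f b)\<^sup>2 \<noteq> f a * f d" if "b\<^sup>2 \<noteq> a * d" for a b d
  proof
    assume "(f b)\<^sup>2 = f a * f d"
    then have "(b\<^sup>2) ^ n = (a * d) ^ n"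
      using \<open>c \<noteq> 0\<close> by (simp add: f power2_eq_square power_mult_distrib)
    with inj that show False by blast
  qed
  then show ?thesis
    using \<open>c \<noteq> 0\<close> \<open>n \<noteq> 0\<close> by (auto simp: preserves_positivity_2_iff[OF char] f)
qed

text \<open>
  Write the two summands as squares \<open>d\<^sup>2\<close> and \<open>e\<^sup>2\<close>, and let \<open>g\<close> be the element with
  \<open>f g = f (d\<^sup>2) + f (e\<^sup>2)\<close>. Since \<open>(f t)\<^sup>2 = f 1 * f (t\<^sup>2)\<close>, the image of the matrix
  \<open>bordered_scalar 1 d e g\<close> is singular. So the matrix itself is not positive definite, and
  as its first two leading minors are \<open>1\<close>, it is singular, that is, \<open>g = d\<^sup>2 + e\<^sup>2\<close>.
\<close>

lemma preserves_positivity_3_additive: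
  fixes f :: "'a::{field,finite} \<Rightarrow> 'a"
  assumes char: "CHAR('a) = 2" and f: "preserves_positivity 3 f"
  shows "f (x + y) = f x + f y"
proof -
  have f2: "preserves_positivity 2 f"
    using preserves_positivity_mono[OF char _ f] by simp
  obtain d where d: "x = d\<^sup>2" by (rule CHAR_2_square_surj[OF char])
  obtain e where e: "y = e\<^sup>2" by (rule CHAR_2_square_surj[OF char])
  have f0: "f 0 = 0" and f1: "f 1 \<noteq> 0"
    by (simp_all add: preserves_positivity_2_zero[OF char f2])
  obtain g where g: "f g = f x + f y"
    using preserves_positivity_2_bij[OF char f2] by (metis bij_pointE)
  have sq: "(f t)\<^sup>2 = f 1 * f (t\<^sup>2)" for t
    by (rule preserves_positivity_2_geometric_mean[OF char f2]) auto
  have "map_mat f (bordered_scalar 1 d e g) = bordered_scalar (f 1) (f d) (f e) (f g)"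
    by (auto simp: bordered_scalar_def f0)
  moreover have "f 1 * f g = (f d)\<^sup>2 + (f e)\<^sup>2"
    by (simp add: sq g d e algebra_simps)
  ultimately have "\<not> positive_definite 3 (bordered_scalar 1 d e g)"
    using f positive_definite_bordered_scalar_iff[OF char] by (metis preserves_positivity_def)
  then have "g = x + y"
    by (simp add: positive_definite_bordered_scalar_iff[OF char] d e)
  with g show ?thesis by simp
qed

lemma preserves_positivity_3_imp_frobenius_power:
  fixes f :: "'a::{field,finite} \<Rightarrow> 'a"
  assumes char: "CHAR('a) = 2" and f: "preserves_positivity 3 f"
  shows "\<exists>c l. c \<noteq> 0 \<and> 2 ^ l < CARD('a) \<and> (\<forall>x. f x = c * x ^ (2 ^ l))"
proof -
  have "preserves_positivity 2 f"
    using preserves_positivity_mono[OF char _ f] by simp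
  then obtain c n where "c \<noteq> 0" and n: "0 < n" "n < CARD('a)" and fn: "\<And>x. f x = c * x ^ n"
    using preserves_positivity_2_imp_power[OF char, of f] CARD_field_gt_1[where 'a = 'a]
    by (auto simp: Suc_le_eq)
  have "(x + 1) ^ n = x ^ n + 1" for x :: 'a
  proof -
    have "c * (x + 1) ^ n = c * (x ^ n + 1)"
      using preserves_positivity_3_additive[OF assms, of x 1] by (simp add: fn distrib_left)
    with \<open>c \<noteq> 0\<close> show ?thesis by simp
  qed
  then obtain l where "n = 2 ^ l"
    using additive_power_exponent[OF n] char by auto
  with \<open>c \<noteq> 0\<close> n fn show ?thesis by blast
qed

lemma frobenius_power_is_automorphism:
  "field_isom (\<lambda>x::'a::{field,finite}. x ^ (CHAR('a) ^ l))"
proof -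
  have "CHAR('a) > 0"
    using prime_CHAR_finite_field[where 'a = 'a] prime_gt_0_nat by blast
  moreover have "surj (\<lambda>x::'a. x ^ (CHAR('a) ^ l))"
    by (rule finite_UNIV_inj_surj[OF finite frobenius_power_inj])
  ultimately show ?thesis
    by unfold_locales
      (auto simp: power_mult_distrib freshmans_dream'[OF prime_CHAR_finite_field refl])
qed

lemma automorphism_preserves_positivity:
  fixes f :: "'a::{field,finite} \<Rightarrow> 'a"
  assumes char: "CHAR('a) = 2" and "nonzero_multiple_of_automorphism f"
  shows "preserves_positivity n f"
  unfolding preserves_positivity_def
proof (intro allI impI)
  fix A :: "'a mat"
  assume A: "positive_definite n A"
  obtain c \<sigma> where "c \<noteq> 0" "field_isom \<sigma>" and f: "\<And>x. f x = c * \<sigma> x"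
    using assms(2) by (auto simp: nonzero_multiple_of_automorphism_def)
  interpret field_isom \<sigma> by fact
  have cA: "A \<in> carrier_mat n n" and tA: "transpose_mat A = A"
    and dA: "\<And>r. r \<in> {1..n} \<Longrightarrow> det (mat r r (\<lambda>ij. A $$ ij)) \<noteq> 0"
    using A by (auto simp: positive_definite_iff_nonzero_minors[OF char])
  have "det (mat r r (\<lambda>ij. map_mat f A $$ ij)) \<noteq> 0" if r: "r \<in> {1..n}" for r
  proof -
    have "mat r r (\<lambda>ij. map_mat f A $$ ij) = c \<cdot>\<^sub>m map_mat \<sigma> (mat r r (\<lambda>ij. A $$ ij))"
      by (intro eq_matI) (use cA r f in auto)
    then show ?thesis using dA[OF r] \<open>c \<noteq> 0\<close> by simp
  qed
  moreover have "transpose_mat (map_mat f A) = map_mat f (transpose_mat A)"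
    by auto
  ultimately show "positive_definite n (map_mat f A)"
    using cA tA by (simp add: positive_definite_iff_nonzero_minors[OF char])
qed

theorem theorem1:
  fixes f :: "'a::{field,finite} \<Rightarrow> 'a" and k q :: nat
  assumes "k > 0" and "q = 2 ^ k" and "CARD('a) = q"
  shows
    "((preserves_positivity 2 f \<longleftrightarrow> bijective_monomial f) \<and>
      (bijective_monomial f \<longleftrightarrow>
        (\<exists>c n. c \<noteq> 0 \<and> 1 \<le> n \<and> n \<le> q - 1 \<and> gcd n (q - 1) = 1 \<and> (\<forall>x. f x = c * x ^ n)))) \<and>
     (((\<exists>n\<ge>3. preserves_positivity n f) \<longleftrightarrow> (\<forall>n\<ge>2. preserves_positivity n f)) \<and>
      ((\<forall>n\<ge>2. preserves_positivity n f) \<longleftrightarrow> nonzero_multiple_of_automorphism f) \<and>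
      (nonzero_multiple_of_automorphism f \<longleftrightarrow>
        (\<exists>c l. c \<noteq> 0 \<and> l \<le> k - 1 \<and> (\<forall>x. f x = c * x ^ (2 ^ l)))))"
    (is "((?pres2 \<longleftrightarrow> ?mono) \<and> (?mono \<longleftrightarrow> ?power)) \<and>
      ((?ex \<longleftrightarrow> ?all) \<and> (?all \<longleftrightarrow> ?aut) \<and> (?aut \<longleftrightarrow> ?frob))")
proof -
  have card: "CARD('a) = 2 ^ k" using assms by simp
  have char: "CHAR('a) = 2" by (rule CHAR_eq_2[OF card \<open>k > 0\<close>])
  have "?mono \<Longrightarrow> ?pres2"
    by (rule bijective_monomial_preserves_positivity_2[OF char])
  moreover have "?pres2 \<Longrightarrow> ?power"
    using preserves_positivity_2_imp_power[OF char] assms(3) by blast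
  moreover have "?power \<Longrightarrow> ?mono"
    using coprime_power_imp_bijective_monomial[of _ _ f] assms(3) by (auto simp: coprime_iff_gcd_eq_1)
  moreover have "?aut \<Longrightarrow> ?all"
    using automorphism_preserves_positivity[OF char] by blast
  moreover have "?all \<Longrightarrow> ?ex"
    by (auto intro: exI[of _ 3])
  moreover have "?ex \<Longrightarrow> ?frob"
  proof -
    assume ?ex
    then have "preserves_positivity 3 f"
      using preserves_positivity_mono[OF char] by blast
    then obtain c l where "c \<noteq> 0" "2 ^ l < CARD('a)" "\<And>x. f x = c * x ^ (2 ^ l)"
      using preserves_positivity_3_imp_frobenius_power[OF char] by blast
    moreover from this have "l < k" using card by simp
    ultimately show ?frob by (intro exI[of _ c] exI[of _ l]) auto
  qed
  moreover have "?frob \<Longrightarrow> ?aut"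
    using frobenius_power_is_automorphism[where 'a = 'a]
    unfolding char nonzero_multiple_of_automorphism_def by blast
  ultimately show ?thesis by argo
qed

end
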